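(* Assume Assumption 1 (stated in the context) holds and $\lambda=\lambda_n>0$ with $\lambda\in o(1)$. Then \[\lim_{\substack{n,d\to\infty\\ d/n\to y}}\left\|\mathbb{E}\left(\hat\Sigma_n+\lambda I\right)^{-1}-\left(\Sigma_n+\lambda I\right)^{-1}\right\|\ \ge\ \frac{y\,\sigma_{\min}}{\sigma_{\max}^2}.\]
   Context: Asymptotic framework: a sequence of problems indexed by $n$, with dimension $d=d(n)$, $n,d\to\infty$ and $d/n\to y\in[0,1)$. For each $n$, $x\in\mathbb{R}^d$ is a random vector with $\mathbb{E}[x]=0$, $\mathrm{Cov}(x)=\Sigma_n$; $x_1,\dots,x_n$ i.i.d. copies of $x$ and $\hat\Sigma_n=\frac1n\sum_{i=1}^n x_ix_i^T$. Empirical spectral distribution $F_{\Sigma_n}(u)=d^{-1}\sum_{i=1}^d\mathbb{I}(\lambda_i\le u)$. $M=\sup_{\|e\|=1}\mathbb{E}(e^Tx)^4$, $\nu=\sup_{\|\Omega\|=1}\mathrm{Var}(x^T\Omega x/d)$. Assumption 1: (A1) $F_{\Sigma_n}(u)\to F_\Sigma(u)$ almost surely for almost every $u\ge0$; (A2) $M<\infty$, $\nu\to0$; (A3) eigenvalues of each $\Sigma_n$ lie in $[\sigma_{\min},\sigma_{\max}]$, $\sigma_{\min}>0$, $\sigma_{\max}$ independent of $n$. $\|\cdot\|$ is the spectral norm. *)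

theory Defs
  imports "HOL-Probability.Probability"
    "Jordan_Normal_Form.Gauss_Jordan_Elimination"
    "Jordan_Normal_Form.Char_Poly"
begin

text \<open>Vectors of dimension d are modelled (for measure-theoretic purposes) as functions
  nat \<Rightarrow> real whose coordinates 0..d-1 are relevant; they are converted to
  Jordan_Normal_Form vectors/matrices where linear algebra is needed.\<close>

definition to_vec :: "nat \<Rightarrow> (nat \<Rightarrow> real) \<Rightarrow> real vec" where
  "to_vec d x = vec d x"

definition vnorm :: "real vec \<Rightarrow> real" where
  "vnorm v = sqrt (scalar_prod v v)"

definition spec_norm :: "real mat \<Rightarrow> real" where
  "spec_norm A = Sup {vnorm (A *\<^sub>v v) | v. v \<in> carrier_vec (dim_col A) \<and> vnorm v = 1}"

definition esd :: "real mat \<Rightarrow> real \<Rightarrow> real" where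
  "esd A u = (\<Sum>k\<in>{k. poly (char_poly A) k = 0 \<and> k \<le> u}. real (order k (char_poly A)))
              / real (dim_row A)"

definition minv :: "real mat \<Rightarrow> real mat" where
  "minv A = the (mat_inverse A)"

definition sample_cov :: "nat \<Rightarrow> nat \<Rightarrow> (nat \<Rightarrow> nat \<Rightarrow> real) \<Rightarrow> real mat" where
  "sample_cov n d xs = mat d d (\<lambda>(i,j). (1 / real n) * (\<Sum>k<n. xs k i * xs k j))"

definition mat_expectation :: "'w measure \<Rightarrow> nat \<Rightarrow> ('w \<Rightarrow> real mat) \<Rightarrow> real mat" where
  "mat_expectation M d X = mat d d (\<lambda>(i,j). integral\<^sup>L M (\<lambda>w. X w $$ (i,j)))"

end

theory Submission
  imports Defs "Jordan_Normal_Form.Schur_Decomposition"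
begin

text \<open>Write \<open>H\<close> for the inverse of the regularized sample covariance with \<open>n\<close> points and let \<open>x\<close>
  be an independent point, so that \<open>q = x \<bullet> H x / n\<close> has mean \<open>tr (E H \<Sigma>) / n\<close>. Let \<open>H'\<close> be the
  inverse obtained after adding \<open>x\<close> to the sample. Taking the trace of \<open>H' (H')\<^sup>-\<^sup>1 = I\<close> and
  using that \<open>x \<bullet> H' x / n = q / (1 + q)\<close> for each of the \<open>n + 1\<close> exchangeable points gives
  \<open>(n + 1) E (1 / (1 + q)) = n + 1 - d + \<lambda> E tr H'\<close>. Jensen's inequality on the left and \<open>tr H' \<le> tr H\<close> on the
  right bound \<open>tr (E H \<Sigma>)\<close> from below, asymptotically by \<open>d / (1 - y)\<close>, whereas
  \<open>tr ((\<Sigma> + \<lambda> I)\<^sup>-\<^sup>1 \<Sigma>) \<le> d\<close>. Since \<open>tr (B \<Sigma>) \<le> \<parallel>B\<parallel> tr \<Sigma>\<close>, this forces the spectral norm of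
  the difference \<open>B\<close> of the two matrices to be at least \<open>y / ((1 - y) \<sigma>\<^sub>m\<^sub>a\<^sub>x)\<close> in the limit. As \<open>\<lambda>\<close> may
  tend to \<open>0\<close> arbitrarily fast, \<open>\<lambda> E tr H\<close> is controlled only through the norm of \<open>B\<close> itself:
  \<open>E tr H \<le> d (\<parallel>B\<parallel> + 1 / \<sigma>\<^sub>m\<^sub>i\<^sub>n)\<close>.\<close>

no_notation inner (infix "\<bullet>" 70)
no_notation vec_nth (infixl "$" 90)

subsection \<open>Linear algebra\<close>

definition mtr :: "'a :: comm_monoid_add mat \<Rightarrow> 'a" where
  "mtr A = (\<Sum>i<dim_row A. A $$ (i,i))"

lemma mtr_mult:
  fixes A B :: "'a :: comm_semiring_0 mat"
  assumes "A \<in> carrier_mat n m" "B \<in> carrier_mat m n"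
  shows "mtr (A * B) = (\<Sum>i<n. \<Sum>j<m. A $$ (i,j) * B $$ (j,i))"
  using assms by (auto simp: mtr_def scalar_prod_def atLeast0LessThan intro!: sum.cong)

lemma mtr_mult_commute:
  fixes A B :: "'a :: comm_semiring_0 mat"
  assumes "A \<in> carrier_mat n m" "B \<in> carrier_mat m n"
  shows "mtr (A * B) = mtr (B * A)"
  unfolding mtr_mult[OF assms] mtr_mult[OF assms(2,1)]
  by (subst sum.swap) (simp add: mult.commute)

lemma mtr_similar:
  fixes A B :: "'a :: comm_ring_1 mat"
  assumes "similar_mat A B"
  shows "mtr A = mtr B"
proof -
  obtain P Q where w: "similar_mat_wit A B P Q"
    using assms by (auto simp: similar_mat_def)
  define n where "n = dim_row A"
  note D = similar_mat_witD[OF n_def w]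
  have "mtr A = mtr (P * (B * Q))"
    using D by simp
  also have "\<dots> = mtr ((B * Q) * P)"
    using D by (intro mtr_mult_commute) auto
  also have "(B * Q) * P = B"
    using D by (simp add: assoc_mult_mat[of _ n n _ n _ n])
  finally show ?thesis .
qed

text \<open>For a complex eigenvector \<open>v\<close> the form \<open>Q\<close> is \<open>k\<close>
  times the positive number \<open>N\<close>, and the symmetry of the real matrix \<open>M\<close>
  makes \<open>Q\<close> its own conjugate.\<close>

lemma symmetric_complex_eigenvalue_real:
  fixes M :: "real mat"
  assumes M: "M \<in> carrier_mat n n"
    and sym: "\<And>i j. i < n \<Longrightarrow> j < n \<Longrightarrow> M $$ (i,j) = M $$ (j,i)"
    and ev: "eigenvalue (map_mat complex_of_real M) k"
  shows "k \<in> \<real>"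
proof -
  obtain v where v: "v \<in> carrier_vec n" "v \<noteq> 0\<^sub>v n"
    "map_mat complex_of_real M *\<^sub>v v = k \<cdot>\<^sub>v v"
    using ev M by (auto simp: eigenvalue_def eigenvector_def)
  have row: "(\<Sum>j<n. of_real (M $$ (i,j)) * v $ j) = k * v $ i" if "i < n" for i
    using arg_cong[OF v(3), of "\<lambda>u. u $ i"] that M v(1)
    by (simp add: scalar_prod_def atLeast0LessThan)
  define N where "N = (\<Sum>i<n. cnj (v $ i) * v $ i)"
  define Q where "Q = (\<Sum>i<n. \<Sum>j<n. cnj (v $ i) * (of_real (M $$ (i,j)) * v $ j))"
  have "Q = k * N"
    unfolding Q_def N_def by (simp add: sum_distrib_left[symmetric] row)
      (simp add: sum_distrib_left mult_ac)
  moreover have "cnj Q = Q"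
    unfolding Q_def cnj_sum
    by (subst sum.swap) (auto simp: sym mult_ac intro!: sum.cong)
  moreover have NR: "N = of_real (\<Sum>i<n. (cmod (v $ i))\<^sup>2)"
    unfolding N_def by (simp add: complex_norm_square mult.commute del: of_real_power)
  moreover have "N \<noteq> 0"
  proof
    assume "N = 0"
    then have "(\<Sum>i<n. (cmod (v $ i))\<^sup>2) = 0"
      using NR by (metis of_real_eq_0_iff)
    then have "\<forall>i<n. v $ i = 0"
      by (simp add: sum_nonneg_eq_0_iff)
    then show False
      using v(1,2) by (metis eq_vecI carrier_vecD index_zero_vec)
  qed
  ultimately have "cnj k = k"
    by (metis complex_cnj_complex_of_real complex_cnj_mult mult_right_cancel)
  then show ?thesis
    by (simp add: Reals_cnj_iff)
qed

text \<open>Stands in for the spectral theorem. The complexified matrix is triangularized by Schur;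
  its diagonal consists of roots of the characteristic polynomial, which are real by the previous
  lemma and hence roots of the real characteristic polynomial.\<close>

lemma symmetric_mtr_eigenvalues:
  fixes M :: "real mat"
  assumes M: "M \<in> carrier_mat n n"
    and sym: "\<And>i j. i < n \<Longrightarrow> j < n \<Longrightarrow> M $$ (i,j) = M $$ (j,i)"
  shows "\<exists>es. length es = n \<and> (\<forall>e\<in>set es. eigenvalue M e) \<and> mtr M = sum_list es"
proof -
  let ?C = "map_mat complex_of_real M"
  have C: "?C \<in> carrier_mat n n"
    using M by simp
  obtain as where as: "char_poly ?C = (\<Prod>a\<leftarrow>as. [:- a, 1:])" "length as = n"
    using char_poly_factorized[OF C] by auto
  obtain B P Q where S: "schur_decomposition ?C as = (B, P, Q)"
    by (cases "schur_decomposition ?C as") auto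
  note sd = schur_decomposition[OF C as(1) S]
  then have sim: "similar_mat ?C B"
    by (auto simp: similar_mat_def)
  have root: "eigenvalue ?C a" if "a \<in> set as" for a
    unfolding eigenvalue_root_char_poly[OF C] as(1)
    using that by (simp add: poly_prod_list prod_list_zero_iff)
  then have re: "complex_of_real (Re a) = a" if "a \<in> set as" for a
    using symmetric_complex_eigenvalue_real[OF M sym] that by simp
  have "complex_of_real (mtr M) = mtr ?C"
    using M by (simp add: mtr_def)
  also have "\<dots> = mtr B"
    by (rule mtr_similar[OF sim])
  also have "\<dots> = sum_list (diag_mat B)"
    by (simp add: mtr_def diag_mat_def sum_list_sum_nth atLeast0LessThan)
  also have "\<dots> = sum_list as"
    using sd by simp
  also have "\<dots> = sum_list (map (complex_of_real \<circ> Re) as)"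
    using re by (simp add: map_idI)
  also have "\<dots> = complex_of_real (sum_list (map Re as))"
    by (induction as) auto
  finally have "mtr M = sum_list (map Re as)"
    using of_real_eq_iff by blast
  moreover have "eigenvalue M (Re a)" if "a \<in> set as" for a
  proof -
    have "poly (char_poly ?C) (complex_of_real (Re a)) = 0"
      using root[OF that] re[OF that] eigenvalue_root_char_poly[OF C] by simp
    then have "complex_of_real (poly (char_poly M) (Re a)) = 0"
      by (simp add: of_real_hom.char_poly_hom[OF M])
    then show ?thesis
      unfolding eigenvalue_root_char_poly[OF M] by simp
  qed
  ultimately show ?thesis
    using as(2) by (intro exI[of _ "map Re as"]) auto
qed

text \<open>Converts eigenvalue bounds into trace bounds, both for the covariance and for its
  regularized inverse.\<close>

lemma symmetric_mtr_le:
  fixes M :: "real mat"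
  assumes "M \<in> carrier_mat n n"
    and "\<And>i j. i < n \<Longrightarrow> j < n \<Longrightarrow> M $$ (i,j) = M $$ (j,i)"
    and le: "\<And>k. eigenvalue M k \<Longrightarrow> k \<le> c"
  shows "mtr M \<le> real n * c"
proof -
  obtain es where es: "length es = n" "\<forall>e\<in>set es. eigenvalue M e" "mtr M = sum_list es"
    using symmetric_mtr_eigenvalues[OF assms(1,2)] by auto
  have "sum_list es \<le> sum_list (map (\<lambda>_. c) es)"
    using es(2) le sum_list_mono[of es "\<lambda>x. x" "\<lambda>_. c"] by simp
  then show ?thesis
    using es by (simp add: sum_list_triv)
qed

text \<open>Serves to deduce \<open>smin \<le> smax\<close>, since the hypothesis on the spectrum
  speaks only of numbers that are eigenvalues.\<close>

lemma symmetric_eigenvalue_ex: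
  fixes M :: "real mat"
  assumes "M \<in> carrier_mat n n" "0 < n"
    and "\<And>i j. i < n \<Longrightarrow> j < n \<Longrightarrow> M $$ (i,j) = M $$ (j,i)"
  shows "\<exists>k. eigenvalue M k"
  using symmetric_mtr_eigenvalues[OF assms(1,3)] assms(2)
  by (metis length_greater_0_conv nth_mem)

section \<open>Quadratic forms, the Euclidean norm and the spectral norm\<close>

lemma smult_one_mult_vec:
  fixes v :: "real vec"
  assumes "v \<in> carrier_vec n"
  shows "(a \<cdot>\<^sub>m 1\<^sub>m n) *\<^sub>v v = a \<cdot>\<^sub>v v"
proof (rule eq_vecI)
  fix i assume "i < dim_vec (a \<cdot>\<^sub>v v)"
  then have i: "i < n" using assms by simp
  have "((a \<cdot>\<^sub>m 1\<^sub>m n) *\<^sub>v v) $ i = (\<Sum>j<n. a * (if j = i then 1 else 0) * v $ j)"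
    using i assms by (simp add: scalar_prod_def atLeast0LessThan)
  also have "\<dots> = (\<Sum>j<n. (if j = i then a * v $ j else 0))"
    by (intro sum.cong) auto
  finally show "((a \<cdot>\<^sub>m 1\<^sub>m n) *\<^sub>v v) $ i = (a \<cdot>\<^sub>v v) $ i"
    using i assms by simp
qed (use assms in simp)

lemma vec_eq_0_iff_scalar_prod:
  fixes v :: "real vec"
  assumes "v \<in> carrier_vec n"
  shows "v \<bullet> v = 0 \<longleftrightarrow> v = 0\<^sub>v n"
proof
  assume "v \<bullet> v = 0"
  then have "\<forall>i<n. v $ i = 0"
    using assms by (simp add: scalar_prod_def sum_nonneg_eq_0_iff)
  then show "v = 0\<^sub>v n"
    using assms by (intro eq_vecI) auto
qed simp

lemma quad_form_sum:
  fixes H :: "real mat"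
  assumes "H \<in> carrier_mat n n" "v \<in> carrier_vec n"
  shows "v \<bullet> (H *\<^sub>v v) = (\<Sum>i<n. \<Sum>j<n. H $$ (i,j) * (v $ i * v $ j))"
  using assms
  by (auto simp: scalar_prod_def atLeast0LessThan sum_distrib_left mult_ac intro!: sum.cong)

lemma quad_form_unit_vec:
  fixes H :: "real mat"
  assumes "H \<in> carrier_mat n n" "i < n" "j < n"
  shows "unit_vec n i \<bullet> (H *\<^sub>v unit_vec n j) = H $$ (i,j)"
  using assms by simp

lemma vnorm_nonneg: "0 \<le> vnorm v"
  by (simp add: vnorm_def scalar_prod_def sum_nonneg)

lemma vnorm_sq: "(vnorm v)\<^sup>2 = v \<bullet> v"
  by (simp add: vnorm_def scalar_prod_def sum_nonneg)

lemma vnorm_smult: "vnorm (a \<cdot>\<^sub>v v) = \<bar>a\<bar> * vnorm v"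
proof -
  have "(a \<cdot>\<^sub>v v) \<bullet> (a \<cdot>\<^sub>v v) = a\<^sup>2 * (v \<bullet> v)"
    by (auto simp: scalar_prod_def sum_distrib_left power2_eq_square mult_ac intro!: sum.cong)
  then show ?thesis
    by (simp add: vnorm_def real_sqrt_mult)
qed

lemma abs_scalar_prod_le_vnorm:
  assumes "u \<in> carrier_vec n" "v \<in> carrier_vec n"
  shows "\<bar>u \<bullet> v\<bar> \<le> vnorm u * vnorm v"
proof -
  have "(u \<bullet> v)\<^sup>2 \<le> (u \<bullet> u) * (v \<bullet> v)"
    using Cauchy_Schwarz_ineq_sum[of "\<lambda>i. u $ i" "\<lambda>i. v $ i" "{0..<n}"] assms
    by (simp add: scalar_prod_def power2_eq_square)
  then have "\<bar>u \<bullet> v\<bar> \<le> sqrt ((u \<bullet> u) * (v \<bullet> v))"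
    by (rule real_le_rsqrt[of "\<bar>u \<bullet> v\<bar>", unfolded power2_abs])
  then show ?thesis
    by (simp add: vnorm_def real_sqrt_mult)
qed

text \<open>The supremum in \<open>spec_norm\<close> bounds its members only once the set is known
  to be bounded above. Cauchy-Schwarz on each row gives the Frobenius norm as a bound.\<close>

lemma vnorm_mult_vec_bounded:
  assumes B: "B \<in> carrier_mat n n"
  shows "\<exists>C. \<forall>v\<in>carrier_vec n. vnorm v = 1 \<longrightarrow> vnorm (B *\<^sub>v v) \<le> C"
proof (intro exI ballI impI)
  fix v :: "real vec" assume v: "v \<in> carrier_vec n" "vnorm v = 1"
  have "\<bar>(B *\<^sub>v v) $ i\<bar> \<le> vnorm (row B i)" if "i < n" for i
    using abs_scalar_prod_le_vnorm[of "row B i" n v] that v B by simp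
  then have "(B *\<^sub>v v) $ i * (B *\<^sub>v v) $ i \<le> (vnorm (row B i))\<^sup>2" if "i < n" for i
    using that abs_le_square_iff[of "(B *\<^sub>v v) $ i" "vnorm (row B i)"]
    by (simp add: vnorm_nonneg power2_eq_square)
  then have "(B *\<^sub>v v) \<bullet> (B *\<^sub>v v) \<le> (\<Sum>i<n. (vnorm (row B i))\<^sup>2)"
    using B unfolding scalar_prod_def by (auto simp: atLeast0LessThan intro!: sum_mono)
  then show "vnorm (B *\<^sub>v v) \<le> sqrt (\<Sum>i<n. (vnorm (row B i))\<^sup>2)"
    by (simp add: vnorm_def)
qed

lemma vnorm_mult_le_spec_norm:
  assumes B: "B \<in> carrier_mat n n" and v: "v \<in> carrier_vec n"
  shows "vnorm (B *\<^sub>v v) \<le> spec_norm B * vnorm v"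
proof (cases "v = 0\<^sub>v n")
  case True
  then have "B *\<^sub>v v = 0\<^sub>v n"
    using B by (intro eq_vecI) auto
  then show ?thesis
    using True by (simp add: vnorm_def)
next
  case False
  then have pos: "vnorm v > 0"
    using vec_eq_0_iff_scalar_prod[OF v] vnorm_nonneg[of v] vnorm_sq[of v]
    by (metis less_eq_real_def power_zero_numeral)
  define u where "u = (1 / vnorm v) \<cdot>\<^sub>v v"
  have u: "u \<in> carrier_vec n" "vnorm u = 1"
    using v pos by (auto simp: u_def vnorm_smult)
  have "bdd_above {vnorm (B *\<^sub>v v) |v. v \<in> carrier_vec (dim_col B) \<and> vnorm v = 1}"
    using vnorm_mult_vec_bounded[OF B] B by (fastforce simp: bdd_above_def)
  then have "vnorm (B *\<^sub>v u) \<le> spec_norm B"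
    unfolding spec_norm_def using u B by (intro cSup_upper) auto
  moreover have "vnorm (B *\<^sub>v u) = vnorm (B *\<^sub>v v) / vnorm v"
    using B v pos by (simp add: u_def mult_mat_vec[OF B v] vnorm_smult)
  ultimately show ?thesis
    using pos by (simp add: field_simps)
qed

lemma abs_quad_form_le_spec_norm:
  assumes "B \<in> carrier_mat n n" "v \<in> carrier_vec n"
  shows "\<bar>v \<bullet> (B *\<^sub>v v)\<bar> \<le> spec_norm B * (v \<bullet> v)"
proof -
  have "\<bar>v \<bullet> (B *\<^sub>v v)\<bar> \<le> vnorm v * vnorm (B *\<^sub>v v)"
    using assms by (intro abs_scalar_prod_le_vnorm) auto
  also have "\<dots> \<le> vnorm v * (spec_norm B * vnorm v)"
    using vnorm_mult_le_spec_norm[OF assms] by (intro mult_left_mono vnorm_nonneg)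
  finally show ?thesis
    by (simp add: power2_eq_square mult_ac flip: vnorm_sq)
qed

lemma abs_diag_le_spec_norm:
  assumes "B \<in> carrier_mat n n" "i < n"
  shows "\<bar>B $$ (i,i)\<bar> \<le> spec_norm B"
  using abs_quad_form_le_spec_norm[OF assms(1), of "unit_vec n i"] assms
  by (simp add: quad_form_unit_vec)

text \<open>In dimension 0 there is no unit vector and \<open>spec_norm\<close> is the supremum of
  the empty set, an unspecified real; hence \<open>0 < n\<close>.\<close>

lemma spec_norm_nonneg:
  assumes "B \<in> carrier_mat n n" "0 < n"
  shows "0 \<le> spec_norm B"
  using abs_diag_le_spec_norm[OF assms] abs_ge_zero order_trans by blast

lemma mtr_le_spec_norm:
  assumes "B \<in> carrier_mat n n"
  shows "mtr B \<le> real n * spec_norm B"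
proof -
  have "B $$ (i,i) \<le> spec_norm B" if "i < n" for i
    using abs_diag_le_spec_norm[OF assms that] by simp
  then have "(\<Sum>i<n. B $$ (i,i)) \<le> (\<Sum>i<n. spec_norm B)"
    by (intro sum_mono) simp
  moreover have "mtr B = (\<Sum>i<n. B $$ (i,i))"
    using assms by (simp add: mtr_def)
  ultimately
  show ?thesis by simp
qed

section \<open>Inverses of positive definite matrices\<close>

text \<open>The lower bound \<open>l\<close> on the spectrum is explicit because it gives bounds on
  the inverse that are uniform over all samples.\<close>

definition pd_mat :: "nat \<Rightarrow> real \<Rightarrow> real mat \<Rightarrow> bool" where
  "pd_mat n l G \<longleftrightarrow> G \<in> carrier_mat n n \<and> 0 < l
    \<and> (\<forall>i<n. \<forall>j<n. G $$ (i,j) = G $$ (j,i))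
    \<and> (\<forall>v\<in>carrier_vec n. l * (v \<bullet> v) \<le> v \<bullet> (G *\<^sub>v v))"

lemma pd_mat_det:
  assumes "pd_mat n l G"
  shows "det G \<noteq> 0"
proof
  have G: "G \<in> carrier_mat n n"
    using assms by (simp add: pd_mat_def)
  assume "det G = 0"
  then obtain v where v: "v \<in> carrier_vec n" "v \<noteq> 0\<^sub>v n" "G *\<^sub>v v = 0\<^sub>v n"
    using det_0_iff_vec_prod_zero[OF G] by auto
  then have "l * (v \<bullet> v) \<le> 0"
    using assms by (fastforce simp: pd_mat_def)
  moreover have "v \<bullet> v > 0"
    using v vec_eq_0_iff_scalar_prod[OF v(1)] vnorm_sq[of v] by (metis less_eq_real_def zero_le_power2)
  ultimately show False
    using assms by (simp add: pd_mat_def mult_le_0_iff)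
qed

lemma minv_inverse:
  fixes G :: "real mat"
  assumes G: "G \<in> carrier_mat n n" and "det G \<noteq> 0"
  shows "minv G \<in> carrier_mat n n" "G * minv G = 1\<^sub>m n" "minv G * G = 1\<^sub>m n"
proof -
  have "G \<in> Units (ring_mat TYPE(real) n ())"
    using det_non_zero_imp_unit[OF assms] .
  then obtain B where B: "mat_inverse G = Some B"
    using mat_inverse(1)[OF G, of "()"] by (cases "mat_inverse G") auto
  then show "minv G \<in> carrier_mat n n" "G * minv G = 1\<^sub>m n" "minv G * G = 1\<^sub>m n"
    using mat_inverse(2)[OF G B] by (auto simp: minv_def)
qed

text \<open>Cramer's rule. It exhibits the entries of the inverse as rational functions of those of
  \<open>G\<close>, from which measurability follows.\<close>

lemma minv_entry:
  fixes G :: "real mat"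
  assumes G: "G \<in> carrier_mat n n" and D: "det G \<noteq> 0" and ij: "i < n" "j < n"
  shows "minv G $$ (i,j) = cofactor G j i / det G"
proof -
  note H = minv_inverse[OF G D]
  have "det G \<cdot>\<^sub>m minv G = (adj_mat G * G) * minv G"
    unfolding adj_mat(3)[OF G] using H by (simp add: mult_smult_assoc_mat[of _ n n _ n])
  also have "\<dots> = adj_mat G"
    using adj_mat(1)[OF G] H G by (simp add: assoc_mult_mat[of _ n n _ n _ n])
  finally have "(det G \<cdot>\<^sub>m minv G) $$ (i,j) = adj_mat G $$ (i,j)"
    by simp
  then show ?thesis
    using G H ij D by (simp add: adj_mat_def field_simps)
qed

context
  fixes n :: nat and l :: real and G :: "real mat"
  assumes pd: "pd_mat n l G"
begin

lemma pd_carrier: "G \<in> carrier_mat n n"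
  using pd by (simp add: pd_mat_def)

lemmas pd_minv = minv_inverse[OF pd_carrier pd_mat_det[OF pd]]

lemma pd_mult_minv_vec:
  assumes "v \<in> carrier_vec n"
  shows "G *\<^sub>v (minv G *\<^sub>v v) = v" "minv G *\<^sub>v (G *\<^sub>v v) = v"
  using assms pd_minv pd_carrier
  by (simp_all flip: assoc_mult_mat_vec[of _ n n _ n])

lemma pd_scalar_prod_sym:
  assumes "u \<in> carrier_vec n" "v \<in> carrier_vec n"
  shows "u \<bullet> (G *\<^sub>v v) = (G *\<^sub>v u) \<bullet> v"
proof -
  have "u \<bullet> (G *\<^sub>v v) = (transpose_mat G *\<^sub>v u) \<bullet> v"
    using assms pd_carrier by (simp add: transpose_vec_mult_scalar)
  moreover have "transpose_mat G = G"
    using pd by (intro eq_matI) (auto simp: pd_mat_def)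
  ultimately show ?thesis by simp
qed

lemma pd_minv_scalar_prod_sym:
  assumes "u \<in> carrier_vec n" "v \<in> carrier_vec n"
  shows "u \<bullet> (minv G *\<^sub>v v) = (minv G *\<^sub>v u) \<bullet> v"
  using pd_scalar_prod_sym[of "minv G *\<^sub>v u" "minv G *\<^sub>v v"] assms pd_minv(1)
  by (simp add: pd_mult_minv_vec)

lemma pd_minv_sym:
  assumes "i < n" "j < n"
  shows "minv G $$ (i,j) = minv G $$ (j,i)"
proof -
  have "minv G $$ (i,j) = (minv G *\<^sub>v unit_vec n i) \<bullet> unit_vec n j"
    using pd_minv_scalar_prod_sym[of "unit_vec n i" "unit_vec n j"]
      quad_form_unit_vec[OF pd_minv(1) assms] by simp
  also have "\<dots> = minv G $$ (j,i)"
    using assms pd_minv(1) by simp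
  finally show ?thesis .
qed

lemma pd_minv_quad_ge:
  assumes "v \<in> carrier_vec n"
  shows "l * ((minv G *\<^sub>v v) \<bullet> (minv G *\<^sub>v v)) \<le> v \<bullet> (minv G *\<^sub>v v)"
proof -
  have "minv G *\<^sub>v v \<in> carrier_vec n"
    using assms pd_minv(1) by simp
  then have "l * ((minv G *\<^sub>v v) \<bullet> (minv G *\<^sub>v v)) \<le> (minv G *\<^sub>v v) \<bullet> (G *\<^sub>v (minv G *\<^sub>v v))"
    using pd by (simp add: pd_mat_def)
  then show ?thesis
    using assms pd_minv(1) by (simp add: pd_mult_minv_vec pd_minv_scalar_prod_sym)
qed

lemma pd_minv_quad_nonneg:
  assumes "v \<in> carrier_vec n"
  shows "0 \<le> v \<bullet> (minv G *\<^sub>v v)"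
proof -
  have "0 \<le> l * (vnorm (minv G *\<^sub>v v))\<^sup>2"
    using pd by (simp add: pd_mat_def)
  then show ?thesis
    using pd_minv_quad_ge[OF assms] by (simp add: vnorm_sq)
qed

text \<open>For the column \<open>u\<close> with index \<open>j\<close>,
  \<open>pd_minv_quad_ge\<close> gives \<open>l * (u \<bullet> u) \<le> u $ j\<close>. This yields
  first \<open>l * u $ j \<le> 1\<close> and then that the square of \<open>l * u $ i\<close> is at
  most 1. The bound depends on \<open>G\<close> only through \<open>l\<close>, so the entries of a
  random inverse are integrable.\<close>

lemma pd_minv_entry_bound:
  assumes ij: "i < n" "j < n"
  shows "\<bar>minv G $$ (i,j)\<bar> \<le> 1 / l"
proof -
  have l: "l > 0"
    using pd by (simp add: pd_mat_def)
  define u where "u = minv G *\<^sub>v unit_vec n j"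
  have u: "u \<in> carrier_vec n"
    using pd_minv(1) by (simp add: u_def)
  have ui: "u $ k = minv G $$ (k,j)" if "k < n" for k
    using that ij pd_minv(1) by (simp add: u_def)
  have sq: "(u $ k)\<^sup>2 \<le> u \<bullet> u" if "k < n" for k
    using u that member_le_sum[of k "{0..<n}" "\<lambda>k. u $ k * u $ k"]
    by (simp add: scalar_prod_def power2_eq_square)
  have le: "l * (u \<bullet> u) \<le> u $ j"
    using pd_minv_quad_ge[of "unit_vec n j"] ij u by (simp add: u_def[symmetric])
  have "l * (u $ j)\<^sup>2 \<le> u $ j"
    using sq[OF ij(2)] le l by (meson mult_left_mono less_imp_le order_trans)
  moreover have "u $ j \<ge> 0"
    using le vnorm_sq[of u] l by (smt (verit) mult_nonneg_nonneg zero_le_power2)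
  ultimately have uj: "l * u $ j \<le> 1"
    using mult_le_cancel_right[of "l * u $ j" "u $ j" 1]
    by (cases "u $ j = 0") (auto simp: power2_eq_square mult.assoc)
  have "(l * u $ i)\<^sup>2 \<le> l * (l * (u \<bullet> u))"
    using sq[OF ij(1)] l by (simp add: power2_eq_square mult_ac mult_left_mono)
  also have "\<dots> \<le> l * u $ j"
    using le l by simp
  finally have "(l * u $ i)\<^sup>2 \<le> 1\<^sup>2"
    using uj by simp
  then have "\<bar>l * u $ i\<bar> \<le> 1"
    by (simp add: abs_le_square_iff[of _ 1, simplified])
  then show ?thesis
    using ui[OF ij(1)] l by (simp add: abs_mult field_simps)
qed

end

section \<open>Rank-one updates\<close>

context
  fixes n :: nat and l c :: real and G G' :: "real mat" and x :: "real vec"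
  assumes pd: "pd_mat n l G" "pd_mat n l G'" and x: "x \<in> carrier_vec n" and c: "0 \<le> c"
    and upd: "\<And>v. v \<in> carrier_vec n \<Longrightarrow> G' *\<^sub>v v = G *\<^sub>v v + (c * (x \<bullet> v)) \<cdot>\<^sub>v x"
begin

text \<open>Sherman-Morrison, tested against \<open>x\<close> only: \<open>G'\<close> sends
  \<open>u = minv G *\<^sub>v x\<close> to \<open>(1 + c * q) \<cdot>\<^sub>v x\<close>, so
  \<open>u\<close> is \<open>1 + c * q\<close> times \<open>minv G' *\<^sub>v x\<close>.\<close>

lemma rank_one_minv_quad:
  "1 - c * (x \<bullet> (minv G' *\<^sub>v x)) = 1 / (1 + c * (x \<bullet> (minv G *\<^sub>v x)))"
proof -
  define u where "u = minv G *\<^sub>v x"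
  define q where "q = x \<bullet> u"
  have u: "u \<in> carrier_vec n"
    using pd_minv(1)[OF pd(1)] x by (simp add: u_def)
  have H': "minv G' \<in> carrier_mat n n"
    by (rule pd_minv(1)[OF pd(2)])
  have q: "0 \<le> c * q"
    using pd_minv_quad_nonneg[OF pd(1) x] c by (simp add: q_def u_def)
  have "G' *\<^sub>v u = (1 + c * q) \<cdot>\<^sub>v x"
    unfolding upd[OF u] using pd_mult_minv_vec(1)[OF pd(1) x] x
    by (simp add: u_def q_def add_smult_distrib_vec)
  then have "u = (1 + c * q) \<cdot>\<^sub>v (minv G' *\<^sub>v x)"
    using pd_mult_minv_vec(2)[OF pd(2) u] mult_mat_vec[OF H' x] by simp
  then have "q = (1 + c * q) * (x \<bullet> (minv G' *\<^sub>v x))"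
    using x H' unfolding q_def by (metis mult_mat_vec_carrier scalar_prod_smult_distrib)
  then show ?thesis
    using q unfolding q_def u_def by (simp add: field_simps)
qed

text \<open>The right side exceeds the left by \<open>c * (1 + c * (x \<bullet> r))\<close> times
  the square of \<open>x \<bullet> w\<close>, which is nonnegative.\<close>

lemma rank_one_minv_quad_le:
  assumes v: "v \<in> carrier_vec n"
  shows "v \<bullet> (minv G' *\<^sub>v v) \<le> v \<bullet> (minv G *\<^sub>v v)"
proof -
  define u where "u = minv G *\<^sub>v v"
  define w where "w = minv G' *\<^sub>v v"
  define r where "r = minv G *\<^sub>v x"
  have car: "u \<in> carrier_vec n" "w \<in> carrier_vec n" "r \<in> carrier_vec n"
    using pd_minv(1)[OF pd(1)] pd_minv(1)[OF pd(2)] x v by (auto simp: u_def w_def r_def)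
  note carG = pd_carrier[OF pd(1)] pd_carrier[OF pd(2)]
  have q: "0 \<le> x \<bullet> r"
    using pd_minv_quad_nonneg[OF pd(1) x] by (simp add: r_def)
  have Gu: "G *\<^sub>v u = v" and Gr: "G *\<^sub>v r = x" and Gw: "G' *\<^sub>v w = v"
    using pd_mult_minv_vec(1)[OF pd(1)] pd_mult_minv_vec(1)[OF pd(2)] x v
    by (auto simp: u_def w_def r_def)
  \<comment> \<open>Evaluate \<open>u \<bullet> (G' *\<^sub>v w)\<close> in two ways: from
    \<open>Gw\<close>, and by expanding the update and moving \<open>G\<close> onto
    \<open>u\<close>.\<close>
  have 1: "v \<bullet> u = v \<bullet> w + c * (x \<bullet> w) * (u \<bullet> x)"
  proof -
    have "v \<bullet> u = u \<bullet> (G' *\<^sub>v w)"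
      using car v Gw by (simp add: comm_scalar_prod)
    also have "\<dots> = u \<bullet> (G *\<^sub>v w) + c * (x \<bullet> w) * (u \<bullet> x)"
      unfolding upd[OF car(2)] using car carG x
      by (simp add: scalar_prod_add_distrib[of _ n])
    also have "u \<bullet> (G *\<^sub>v w) = v \<bullet> w"
      using pd_scalar_prod_sym[OF pd(1) car(1,2)] Gu by simp
    finally show ?thesis .
  qed
  \<comment> \<open>The same computation with \<open>r\<close> in place of \<open>u\<close>
    expresses \<open>u \<bullet> x\<close> through \<open>x \<bullet> w\<close>.\<close>
  have 2: "u \<bullet> x = (1 + c * (x \<bullet> r)) * (x \<bullet> w)"
  proof -
    have "u \<bullet> x = v \<bullet> r"
      using pd_scalar_prod_sym[OF pd(1) car(1,3)] Gu Gr by simp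
    also have "\<dots> = r \<bullet> (G' *\<^sub>v w)"
      using car v Gw by (simp add: comm_scalar_prod)
    also have "\<dots> = r \<bullet> (G *\<^sub>v w) + c * (x \<bullet> w) * (r \<bullet> x)"
      unfolding upd[OF car(2)] using car carG x
      by (simp add: scalar_prod_add_distrib[of _ n])
    also have "r \<bullet> (G *\<^sub>v w) = x \<bullet> w"
      using pd_scalar_prod_sym[OF pd(1) car(3,2)] Gr by simp
    finally show ?thesis
      using comm_scalar_prod[OF car(3) x] by (simp add: algebra_simps)
  qed
  have "0 \<le> c * ((1 + c * (x \<bullet> r)) * (x \<bullet> w)\<^sup>2)"
    using c q by simp
  then show ?thesis
    using 1 unfolding 2 by (simp add: u_def w_def power2_eq_square mult_ac)
qed

lemma rank_one_mtr_minv_le: "mtr (minv G') \<le> mtr (minv G)"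
proof -
  have "minv G' $$ (i,i) \<le> minv G $$ (i,i)" if "i < n" for i
    using rank_one_minv_quad_le[of "unit_vec n i"] that
      quad_form_unit_vec[OF pd_minv(1)[OF pd(1)] that that]
      quad_form_unit_vec[OF pd_minv(1)[OF pd(2)] that that] by simp
  then show ?thesis
    using pd_minv(1)[OF pd(1)] pd_minv(1)[OF pd(2)] by (auto simp: mtr_def intro!: sum_mono)
qed

end

subsection \<open>Regularized sample covariance\<close>

text \<open>The scale \<open>c\<close> is independent of the size of \<open>J\<close>: it stays
  \<open>1 / n\<close> when a further point joins the \<open>n\<close> points, so that enlarging
  \<open>J\<close> is a pure rank-one update.\<close>

definition reg_cov :: "nat \<Rightarrow> real \<Rightarrow> real \<Rightarrow> nat set \<Rightarrow> (nat \<Rightarrow> nat \<Rightarrow> real) \<Rightarrow> real mat" where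
  "reg_cov d l c J xs = mat d d (\<lambda>(i,j). c * (\<Sum>k\<in>J. xs k i * xs k j)) + l \<cdot>\<^sub>m 1\<^sub>m d"

lemma reg_cov_carrier [simp]: "reg_cov d l c J xs \<in> carrier_mat d d"
  by (simp add: reg_cov_def)

lemma reg_cov_index [simp]:
  assumes "i < d" "j < d"
  shows "reg_cov d l c J xs $$ (i,j) = c * (\<Sum>k\<in>J. xs k i * xs k j) + (if i = j then l else 0)"
  using assms by (simp add: reg_cov_def)

lemma to_vec_carrier [simp]: "to_vec d x \<in> carrier_vec d"
  by (simp add: to_vec_def)

lemma to_vec_index [simp]: "i < d \<Longrightarrow> to_vec d x $ i = x i"
  by (simp add: to_vec_def)

lemma reg_cov_insert_mult_vec:
  assumes "finite J" "k \<notin> J" "v \<in> carrier_vec d"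
  shows "reg_cov d l c (insert k J) xs *\<^sub>v v
    = reg_cov d l c J xs *\<^sub>v v + (c * (to_vec d (xs k) \<bullet> v)) \<cdot>\<^sub>v to_vec d (xs k)"
proof (rule eq_vecI)
  let ?r = "reg_cov d l c J xs *\<^sub>v v + (c * (to_vec d (xs k) \<bullet> v)) \<cdot>\<^sub>v to_vec d (xs k)"
  have dim: "dim_row (reg_cov d l c K xs) = d" "dim_col (reg_cov d l c K xs) = d" for K
    by (simp_all add: carrier_matD[OF reg_cov_carrier])
  show "dim_vec (reg_cov d l c (insert k J) xs *\<^sub>v v) = dim_vec ?r"
    by (simp add: dim to_vec_def)
  fix i assume "i < dim_vec ?r"
  then have i: "i < d" by (simp add: to_vec_def)
  have "(reg_cov d l c (insert k J) xs *\<^sub>v v) $ i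
    = (\<Sum>j<d. reg_cov d l c (insert k J) xs $$ (i,j) * v $ j)"
    using i assms(3) by (simp add: dim scalar_prod_def atLeast0LessThan)
  also have "\<dots> = (\<Sum>j<d. reg_cov d l c J xs $$ (i,j) * v $ j + c * (xs k j * v $ j) * xs k i)"
    using i assms(1,2) by (intro sum.cong refl) (auto simp: algebra_simps)
  also have "\<dots> = ?r $ i"
    using i assms(3)
    by (simp add: dim scalar_prod_def atLeast0LessThan sum.distrib sum_distrib_left
        sum_distrib_right to_vec_def)
  finally show "(reg_cov d l c (insert k J) xs *\<^sub>v v) $ i = ?r $ i" .
qed

lemma reg_cov_pd:
  assumes "finite J" "0 < l" "0 \<le> c"
  shows "pd_mat d l (reg_cov d l c J xs)"
proof -
  have "l * (v \<bullet> v) \<le> v \<bullet> (reg_cov d l c J xs *\<^sub>v v)" if v: "v \<in> carrier_vec d" for v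
    using assms(1)
  proof induction
    case empty
    have "reg_cov d l c {} xs = l \<cdot>\<^sub>m 1\<^sub>m d"
      by (rule eq_matI) (auto simp: reg_cov_def)
    moreover have "(l \<cdot>\<^sub>m 1\<^sub>m d) *\<^sub>v v = l \<cdot>\<^sub>v v"
      using v by (simp add: smult_one_mult_vec[of _ d])
    ultimately show ?case using v by simp
  next
    case (insert k J)
    let ?x = "to_vec d (xs k)"
    have "reg_cov d l c J xs *\<^sub>v v \<in> carrier_vec d"
      by (rule mult_mat_vec_carrier[OF reg_cov_carrier v])
    then have "v \<bullet> (reg_cov d l c (insert k J) xs *\<^sub>v v)
      = v \<bullet> (reg_cov d l c J xs *\<^sub>v v) + c * (?x \<bullet> v) * (v \<bullet> ?x)"
      unfolding reg_cov_insert_mult_vec[OF insert(1,2) v] using v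
      by (simp add: scalar_prod_add_distrib[of _ d])
    moreover have "0 \<le> c * (?x \<bullet> v) * (v \<bullet> ?x)"
      using assms(3) comm_scalar_prod[OF v, of ?x] by (simp add: mult.assoc)
    ultimately show ?case
      using insert.IH by linarith
  qed
  then show ?thesis
    using assms(2) by (simp add: pd_mat_def mult.commute)
qed

text \<open>The trace of \<open>H * reg_cov d l c J xs\<close>, an identity matrix, split into the
  contributions of the points and \<open>l * mtr H\<close>.\<close>

lemma reg_cov_mtr_identity:
  fixes xs :: "nat \<Rightarrow> nat \<Rightarrow> real"
  assumes "finite J" "0 < l" "0 \<le> c"
    and H_def: "H = minv (reg_cov d l c J xs)"
  shows "(\<Sum>k\<in>J. c * (to_vec d (xs k) \<bullet> (H *\<^sub>v to_vec d (xs k)))) = real d - l * mtr H"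
proof -
  note pd = reg_cov_pd[OF assms(1-3), of d xs]
  note H = pd_minv[OF pd, folded H_def]
  have "real d = mtr (H * reg_cov d l c J xs)"
    unfolding H by (simp add: mtr_def)
  also have "\<dots> = (\<Sum>i<d. \<Sum>j<d. H $$ (i,j) * (c * (\<Sum>k\<in>J. xs k i * xs k j))
      + (if i = j then l * H $$ (i,j) else 0))"
    unfolding mtr_mult[OF H(1) reg_cov_carrier]
    by (intro sum.cong refl) (auto simp: algebra_simps)
  also have "\<dots> = (\<Sum>i<d. \<Sum>j<d. H $$ (i,j) * (c * (\<Sum>k\<in>J. xs k i * xs k j))) + l * mtr H"
    using H(1) by (simp add: sum.distrib mtr_def sum_distrib_left)
  also have "(\<Sum>i<d. \<Sum>j<d. H $$ (i,j) * (c * (\<Sum>k\<in>J. xs k i * xs k j)))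
    = (\<Sum>k\<in>J. c * (to_vec d (xs k) \<bullet> (H *\<^sub>v to_vec d (xs k))))"
    unfolding quad_form_sum[OF H(1) to_vec_carrier]
    by (simp add: sum_distrib_left sum.swap[of _ _ J] mult_ac)
  finally show ?thesis by simp
qed

lemma reg_cov_cong:
  assumes "\<And>k. k \<in> J \<Longrightarrow> xs k = ys k"
  shows "reg_cov d l c J xs = reg_cov d l c J ys"
  using assms by (intro eq_matI) (auto intro!: sum.cong simp: carrier_matD[OF reg_cov_carrier])

lemma reg_cov_reindex:
  assumes "bij_betw f K J"
  shows "reg_cov d l c J xs = reg_cov d l c K (\<lambda>k. xs (f k))"
  by (intro eq_matI)
    (auto simp: carrier_matD[OF reg_cov_carrier] sum.reindex_bij_betw[OF assms, symmetric])

section \<open>Measurability of determinants and inverses\<close>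

lemma borel_measurable_det:
  assumes "\<And>w. X w \<in> carrier_mat n n"
    and "\<And>i j. i < n \<Longrightarrow> j < n \<Longrightarrow> (\<lambda>w. X w $$ (i,j) :: real) \<in> borel_measurable M"
  shows "(\<lambda>w. Determinant.det (X w)) \<in> borel_measurable M"
proof -
  have "(\<lambda>w. Determinant.det (X w)) = (\<lambda>w. \<Sum>p | p permutes {0..<n}. signof p * (\<Prod>i = 0..<n. X w $$ (i, p i)))"
    using det_def'[OF assms(1)] by auto
  also have "\<dots> \<in> borel_measurable M"
    using assms(2)
    by (intro borel_measurable_sum borel_measurable_times borel_measurable_const borel_measurable_prod)
      (auto simp: permutes_in_image)
  finally show ?thesis .
qed

lemma borel_measurable_minv:
  assumes X: "\<And>w. X w \<in> carrier_mat n n" and D: "\<And>w. Determinant.det (X w) \<noteq> 0"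
    and m: "\<And>i j. i < n \<Longrightarrow> j < n \<Longrightarrow> (\<lambda>w. X w $$ (i,j) :: real) \<in> borel_measurable M"
    and ij: "i < n" "j < n"
  shows "(\<lambda>w. minv (X w) $$ (i,j)) \<in> borel_measurable M"
proof -
  have "(\<lambda>w. minv (X w) $$ (i,j))
    = (\<lambda>w. (-1) ^ (j + i) * Determinant.det (mat_delete (X w) j i) / Determinant.det (X w))"
    using minv_entry[OF X D ij] by (simp add: cofactor_def)
  moreover have "(\<lambda>w. Determinant.det (mat_delete (X w) j i)) \<in> borel_measurable M"
  proof (rule borel_measurable_det[of _ "n - 1"])
    show "mat_delete (X w) j i \<in> carrier_mat (n - 1) (n - 1)" for w
      using X[of w] by (simp add: mat_delete_def)
    fix a b assume ab: "a < n - 1" "b < n - 1"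
    have "mat_delete (X w) j i $$ (a,b)
      = X w $$ (if a < j then a else Suc a, if b < i then b else Suc b)" for w
      using ab carrier_matD[OF X[of w]] by (simp add: mat_delete_def)
    then show "(\<lambda>w. mat_delete (X w) j i $$ (a,b)) \<in> borel_measurable M"
      using ab by (auto intro!: m)
  qed
  ultimately show ?thesis
    using borel_measurable_det[OF X m] by (simp add: borel_measurable_divide borel_measurable_times)
qed

subsection \<open>Expectations\<close>

text \<open>Jensen's inequality for \<open>1 / a\<close> is used through this tangent line.\<close>

lemma tangent_le_inverse:
  fixes a t :: real
  assumes "0 < a"
  shows "2 * t - t\<^sup>2 * a \<le> 1 / a"
proof -
  have "0 \<le> (1 - t * a)\<^sup>2" by simp
  then show ?thesis
    using assms by (simp add: field_simps power2_eq_square)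
qed

section \<open>A random vector with second-moment matrix \<open>S\<close>\<close>

locale second_moment_model = prob_space N
  for N :: "(nat \<Rightarrow> real) measure" +
  fixes d :: nat and S :: "real mat"
  assumes sets_N: "sets N = sets (PiM {..<d} (\<lambda>_. borel))"
    and S_carrier: "S \<in> carrier_mat d d"
    and second_moments: "\<And>i j. i < d \<Longrightarrow> j < d \<Longrightarrow>
      integrable N (\<lambda>x. x i * x j) \<and> S $$ (i,j) = integral\<^sup>L N (\<lambda>x. x i * x j)"
begin

sublocale P: product_prob_space "\<lambda>_ :: nat. N"
  by unfold_locales

lemma coordinate_measurable:
  assumes "i < d"
  shows "(\<lambda>x. x i) \<in> borel_measurable N"
  unfolding measurable_cong_sets[OF sets_N refl]
  using assms by (intro measurable_component_singleton) simp

lemma sample_coordinate_measurable: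
  assumes "k \<in> J" "i < d"
  shows "(\<lambda>xs. xs k i) \<in> borel_measurable (PiM J (\<lambda>_. N))"
  using measurable_compose[OF measurable_component_singleton[OF assms(1), of "\<lambda>_. N"]
      coordinate_measurable[OF assms(2)]] .

lemma S_sym: "i < d \<Longrightarrow> j < d \<Longrightarrow> S $$ (i,j) = S $$ (j,i)"
  using second_moments by (simp add: mult.commute)

lemma quad_form_expectation:
  assumes "B \<in> carrier_mat d d"
  shows "integrable N (\<lambda>x. to_vec d x \<bullet> (B *\<^sub>v to_vec d x))"
    and "expectation (\<lambda>x. to_vec d x \<bullet> (B *\<^sub>v to_vec d x)) = mtr (B * S)"
proof -
  have i: "integrable N (\<lambda>x. B $$ (i,j) * (x i * x j))" if "i < d" "j < d" for i j
    using second_moments[OF that] by simp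
  have eq: "to_vec d x \<bullet> (B *\<^sub>v to_vec d x) = (\<Sum>i<d. \<Sum>j<d. B $$ (i,j) * (x i * x j))" for x
    unfolding quad_form_sum[OF assms to_vec_carrier] by simp
  show "integrable N (\<lambda>x. to_vec d x \<bullet> (B *\<^sub>v to_vec d x))"
    unfolding eq by (intro Bochner_Integration.integrable_sum i) auto
  have "expectation (\<lambda>x. to_vec d x \<bullet> (B *\<^sub>v to_vec d x))
    = (\<Sum>i<d. \<Sum>j<d. expectation (\<lambda>x. B $$ (i,j) * (x i * x j)))"
    unfolding eq
    by (subst Bochner_Integration.integral_sum, (intro Bochner_Integration.integrable_sum i; simp), intro sum.cong refl Bochner_Integration.integral_sum i) auto
  also have "\<dots> = mtr (B * S)"
    unfolding mtr_mult[OF assms S_carrier] using second_moments S_sym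
    by (auto intro!: sum.cong)
  finally show "expectation (\<lambda>x. to_vec d x \<bullet> (B *\<^sub>v to_vec d x)) = mtr (B * S)" .
qed

text \<open>The left side is the mean of a quadratic form in \<open>x\<close>, which is bounded
  pointwise by \<open>spec_norm B\<close> times the squared length of \<open>x\<close>; the mean of
  that squared length is \<open>mtr S\<close>.\<close>

lemma mtr_mult_S_le_spec_norm:
  assumes B: "B \<in> carrier_mat d d"
  shows "mtr (B * S) \<le> spec_norm B * mtr S"
proof -
  \<comment> \<open>The identity matrix is inserted so that the squared length also falls under
    \<open>quad_form_expectation\<close>.\<close>
  have one: "to_vec d x \<bullet> (1\<^sub>m d *\<^sub>v to_vec d x) = to_vec d x \<bullet> to_vec d x" for x
    by (simp add: one_mult_mat_vec[OF to_vec_carrier])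
  have "expectation (\<lambda>x. to_vec d x \<bullet> (B *\<^sub>v to_vec d x))
    \<le> expectation (\<lambda>x. spec_norm B * (to_vec d x \<bullet> (1\<^sub>m d *\<^sub>v to_vec d x)))"
    using abs_quad_form_le_spec_norm[OF B to_vec_carrier]
    by (intro integral_mono integrable_mult_right quad_form_expectation B)
      (auto simp: one abs_le_iff)
  also have "\<dots> = spec_norm B * mtr S"
    using S_carrier quad_form_expectation(2)[of "1\<^sub>m d"] by simp
  finally show ?thesis
    using quad_form_expectation[OF B] by simp
qed

text \<open>The form is the mean of the square of \<open>v \<bullet> x\<close>, obtained as
  \<open>mtr (B * S)\<close> for the rank-one matrix \<open>B\<close> built from
  \<open>v\<close>.\<close>

lemma S_quad_nonneg:
  assumes v: "v \<in> carrier_vec d"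
  shows "0 \<le> v \<bullet> (S *\<^sub>v v)"
proof -
  define B where "B = mat d d (\<lambda>(i,j). v $ i * v $ j)"
  have B: "B \<in> carrier_mat d d" by (simp add: B_def)
  have "to_vec d x \<bullet> (B *\<^sub>v to_vec d x) = (\<Sum>i<d. v $ i * x i)\<^sup>2" for x
    unfolding quad_form_sum[OF B to_vec_carrier] power2_eq_square sum_product
    by (intro sum.cong refl) (simp add: B_def mult_ac)
  then have "0 \<le> mtr (B * S)"
    unfolding quad_form_expectation(2)[OF B, symmetric] by simp
  also have "mtr (B * S) = v \<bullet> (S *\<^sub>v v)"
    unfolding mtr_mult[OF B S_carrier] quad_form_sum[OF S_carrier v]
    by (intro sum.cong refl) (simp add: B_def S_sym mult_ac)
  finally show ?thesis .
qed

lemma S_reg_pd: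
  assumes "0 < l"
  shows "pd_mat d l (S + l \<cdot>\<^sub>m 1\<^sub>m d)"
proof -
  have "(S + l \<cdot>\<^sub>m 1\<^sub>m d) *\<^sub>v v = S *\<^sub>v v + l \<cdot>\<^sub>v v" if "v \<in> carrier_vec d" for v
    using that S_carrier
    by (simp add: add_mult_distrib_mat_vec[of _ d d] smult_one_mult_vec[of _ d])
  then have "l * (v \<bullet> v) \<le> v \<bullet> ((S + l \<cdot>\<^sub>m 1\<^sub>m d) *\<^sub>v v)" if "v \<in> carrier_vec d" for v
    using that S_quad_nonneg[OF that] S_carrier by (simp add: scalar_prod_add_distrib[of _ d])
  then show ?thesis
    using assms S_carrier S_sym by (simp add: pd_mat_def)
qed

text \<open>The product of \<open>H\<close> with its inverse has trace \<open>d\<close>; the dropped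
  part \<open>l * mtr H\<close> is nonnegative.\<close>

lemma mtr_reg_inverse_mult_S_le:
  assumes l: "0 < l"
  defines "H \<equiv> minv (S + l \<cdot>\<^sub>m 1\<^sub>m d)"
  shows "mtr (H * S) \<le> real d"
proof -
  note pd = S_reg_pd[OF l]
  note H = pd_minv[OF pd, folded H_def]
  have "real d = mtr (H * (S + l \<cdot>\<^sub>m 1\<^sub>m d))"
    unfolding H by (simp add: mtr_def)
  also have "H * (S + l \<cdot>\<^sub>m 1\<^sub>m d) = H * S + l \<cdot>\<^sub>m H"
    using H(1) S_carrier by (simp add: mult_add_distrib_mat[of _ d d] mult_smult_distrib[of _ d d _ d])
  also have "mtr \<dots> = mtr (H * S) + l * mtr H"
    using H(1) S_carrier by (simp add: mtr_def sum.distrib sum_distrib_left)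
  finally have "real d = mtr (H * S) + l * mtr H" .
  moreover have "0 \<le> H $$ (i,i)" if "i < d" for i
    using pd_minv_quad_nonneg[OF pd, of "unit_vec d i"] that
      quad_form_unit_vec[OF H(1) that that] by (simp add: H_def)
  then have "0 \<le> mtr H"
    using H(1) by (auto simp: mtr_def intro: sum_nonneg)
  ultimately show ?thesis
    using l by (smt (verit) mult_nonneg_nonneg)
qed

text \<open>An eigenvalue \<open>k\<close> of the inverse gives the eigenvalue
  \<open>1 / k - l\<close> of \<open>S\<close>, so \<open>m \<le> 1 / k\<close>.\<close>

lemma mtr_reg_inverse_le:
  assumes l: "0 < l" and m: "0 < m" and ev: "\<And>k. eigenvalue S k \<Longrightarrow> m \<le> k"
  shows "mtr (minv (S + l \<cdot>\<^sub>m 1\<^sub>m d)) \<le> real d * (1 / m)"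
proof (rule symmetric_mtr_le)
  note pd = S_reg_pd[OF l]
  let ?H = "minv (S + l \<cdot>\<^sub>m 1\<^sub>m d)"
  show H: "?H \<in> carrier_mat d d"
    by (rule pd_minv(1)[OF pd])
  show "?H $$ (i,j) = ?H $$ (j,i)" if "i < d" "j < d" for i j
    by (rule pd_minv_sym[OF pd that])
  fix k assume "eigenvalue ?H k"
  then obtain v where v: "v \<in> carrier_vec d" "v \<noteq> 0\<^sub>v d" "?H *\<^sub>v v = k \<cdot>\<^sub>v v"
    using H by (auto simp: eigenvalue_def eigenvector_def)
  have "v = (S + l \<cdot>\<^sub>m 1\<^sub>m d) *\<^sub>v (k \<cdot>\<^sub>v v)"
    using pd_mult_minv_vec(1)[OF pd v(1)] v(3) by simp
  also have "\<dots> = k \<cdot>\<^sub>v (S *\<^sub>v v + l \<cdot>\<^sub>v v)"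
    using v(1) S_carrier
    by (simp add: add_mult_distrib_mat_vec[of _ d d] smult_one_mult_vec[of _ d] mult_mat_vec[of _ d d])
  finally have veq: "v = k \<cdot>\<^sub>v (S *\<^sub>v v + l \<cdot>\<^sub>v v)" .
  have k: "k \<noteq> 0"
  proof (intro notI)
    assume "k = 0"
    then have "v $ i = 0" if "i < d" for i
      using arg_cong[OF veq, of "\<lambda>u. u $ i"] that v(1) S_carrier by simp
    then show False
      using v(1,2) by (metis eq_vecI carrier_vecD index_zero_vec)
  qed
  have "(S *\<^sub>v v) $ i = (1 / k - l) * v $ i" if "i < d" for i
    using arg_cong[OF veq, of "\<lambda>u. u $ i"] that v(1) S_carrier k by (simp add: field_simps)
  then have "S *\<^sub>v v = (1 / k - l) \<cdot>\<^sub>v v"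
    using v(1) S_carrier by (intro eq_vecI) auto
  then have "eigenvalue S (1 / k - l)"
    using v(1,2) S_carrier unfolding eigenvalue_def eigenvector_def by auto
  then have "m \<le> 1 / k"
    using ev l by fastforce
  then show "k \<le> 1 / m"
    using m by (smt (verit) divide_le_0_1_iff le_divide_eq mult.commute)
qed

text \<open>Fubini for splitting off the point \<open>k\<close>; the uniform bound \<open>C\<close>
  supplies integrability at each stage.\<close>

lemma PiM_insert_bounded:
  fixes f :: "(nat \<Rightarrow> nat \<Rightarrow> real) \<Rightarrow> real"
  assumes K: "finite K" "k \<notin> K" and f: "f \<in> borel_measurable (PiM (insert k K) (\<lambda>_. N))"
    and C: "\<And>xs. \<bar>f xs\<bar> \<le> C"
  shows "integrable (PiM (insert k K) (\<lambda>_. N)) f"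
    and "integrable (PiM K (\<lambda>_. N)) (\<lambda>xs. \<integral>y. f (xs(k := y)) \<partial>N)"
    and "integral\<^sup>L (PiM (insert k K) (\<lambda>_. N)) f = (\<integral>xs. (\<integral>y. f (xs(k := y)) \<partial>N) \<partial>PiM K (\<lambda>_. N))"
    and "\<And>xs. xs \<in> space (PiM K (\<lambda>_. N)) \<Longrightarrow> integrable N (\<lambda>y. f (xs(k := y)))"
proof -
  interpret I: prob_space "PiM (insert k K) (\<lambda>_. N)"
    by (intro prob_space_PiM prob_space_axioms)
  interpret K: prob_space "PiM K (\<lambda>_. N)"
    by (intro prob_space_PiM prob_space_axioms)
  show int: "integrable (PiM (insert k K) (\<lambda>_. N)) f"
    using f C by (intro I.integrable_const_bound[of _ C]) auto
  show "integral\<^sup>L (PiM (insert k K) (\<lambda>_. N)) f = (\<integral>xs. (\<integral>y. f (xs(k := y)) \<partial>N) \<partial>PiM K (\<lambda>_. N))"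
    by (rule P.product_integral_insert[OF K int])
  have m2: "(\<lambda>(xs, y). f (xs(k := y))) \<in> borel_measurable (PiM K (\<lambda>_. N) \<Otimes>\<^sub>M N)"
    using measurable_compose[OF measurable_add_dim[of k K "\<lambda>_. N"] f]
    by (simp add: case_prod_beta')
  then have m1: "(\<lambda>xs. \<integral>y. f (xs(k := y)) \<partial>N) \<in> borel_measurable (PiM K (\<lambda>_. N))"
    by (rule borel_measurable_lebesgue_integral)
  show int1: "integrable N (\<lambda>y. f (xs(k := y)))" if "xs \<in> space (PiM K (\<lambda>_. N))" for xs
    using measurable_Pair2[OF m2 that] C by (intro integrable_const_bound[of _ C]) auto
  have "\<bar>\<integral>y. f (xs(k := y)) \<partial>N\<bar> \<le> C" if "xs \<in> space (PiM K (\<lambda>_. N))" for xs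
  proof -
    have "\<bar>\<integral>y. f (xs(k := y)) \<partial>N\<bar> \<le> (\<integral>y. \<bar>f (xs(k := y))\<bar> \<partial>N)"
      by (rule integral_abs_bound)
    also have "\<dots> \<le> C"
      using int1[OF that] C by (intro integral_le_const) auto
    finally show ?thesis .
  qed
  then show "integrable (PiM K (\<lambda>_. N)) (\<lambda>xs. \<integral>y. f (xs(k := y)) \<partial>N)"
    using m1 by (intro K.integrable_const_bound[of _ C]) auto
qed

end

section \<open>Leave-one-out expectations\<close>

locale ridge_model = second_moment_model +
  fixes l c :: real
  assumes l: "0 < l" and c: "0 \<le> c"
begin

abbreviation H :: "nat set \<Rightarrow> (nat \<Rightarrow> nat \<Rightarrow> real) \<Rightarrow> real mat" where
  "H J xs \<equiv> minv (reg_cov d l c J xs)"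

abbreviation q :: "nat set \<Rightarrow> (nat \<Rightarrow> nat \<Rightarrow> real) \<Rightarrow> (nat \<Rightarrow> real) \<Rightarrow> real" where
  "q J xs x \<equiv> to_vec d x \<bullet> (H J xs *\<^sub>v to_vec d x)"

lemma pd: "finite J \<Longrightarrow> pd_mat d l (reg_cov d l c J xs)"
  using reg_cov_pd l c by simp

lemma H_carrier: "finite J \<Longrightarrow> H J xs \<in> carrier_mat d d"
  by (rule pd_minv(1)[OF pd])

lemma H_measurable:
  assumes J: "finite J" "J \<subseteq> J'" and "i < d" "j < d"
  shows "(\<lambda>xs. H J xs $$ (i,j)) \<in> borel_measurable (PiM J' (\<lambda>_. N))"
proof (rule borel_measurable_minv[OF reg_cov_carrier pd_mat_det[OF pd[OF J(1)]] _ assms(3,4)])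
  fix i j assume "i < d" "j < d"
  then show "(\<lambda>xs. reg_cov d l c J xs $$ (i,j)) \<in> borel_measurable (PiM J' (\<lambda>_. N))"
    using J by (auto intro!: borel_measurable_add borel_measurable_times borel_measurable_sum
        borel_measurable_const sample_coordinate_measurable)
qed

lemma H_integrable:
  assumes "finite J" "i < d" "j < d"
  shows "integrable (PiM J (\<lambda>_. N)) (\<lambda>xs. H J xs $$ (i,j))"
proof -
  interpret J: prob_space "PiM J (\<lambda>_. N)"
    by (intro prob_space_PiM prob_space_axioms)
  show ?thesis
    using H_measurable[of J J] pd_minv_entry_bound[OF pd] assms
    by (intro J.integrable_const_bound[of _ "1 / l"]) auto
qed

lemma mtr_H_mult_integrable:
  assumes "finite J" "B \<in> carrier_mat d d"
  shows "integrable (PiM J (\<lambda>_. N)) (\<lambda>xs. mtr (H J xs * B))"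
  unfolding mtr_mult[OF H_carrier[OF assms(1)] assms(2)]
  by (intro Bochner_Integration.integrable_sum integrable_mult_left H_integrable assms(1)) auto

lemma mtr_H_integrable:
  assumes "finite J"
  shows "integrable (PiM J (\<lambda>_. N)) (\<lambda>xs. mtr (H J xs))"
  using mtr_H_mult_integrable[OF assms, of "1\<^sub>m d"]
  by (simp add: right_mult_one_mat[OF H_carrier[OF assms]])

lemma quad_form_measurable:
  assumes J: "finite J" "insert k J \<subseteq> J'"
  shows "(\<lambda>xs. q J xs (xs k)) \<in> borel_measurable (PiM J' (\<lambda>_. N))"
  unfolding quad_form_sum[OF H_carrier[OF J(1)] to_vec_carrier]
  using J by (auto intro!: borel_measurable_sum borel_measurable_times H_measurable
      sample_coordinate_measurable)

text \<open>Exchangeability: relabelling by \<open>f\<close> carries one product measure to the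
  other, so only the number of points matters.\<close>

lemma mtr_H_mult_exchange:
  assumes f: "bij_betw f K J" and K: "finite K" and B: "B \<in> carrier_mat d d"
  shows "(\<integral>xs. mtr (H J xs * B) \<partial>PiM J (\<lambda>_. N)) = (\<integral>xs. mtr (H K xs * B) \<partial>PiM K (\<lambda>_. N))"
proof -
  \<comment> \<open>Restricting to \<open>K\<close> places the relabelled sample in the space of the
    product over \<open>K\<close>, whose members are \<open>undefined\<close> outside
    \<open>K\<close>.\<close>
  let ?r = "\<lambda>xs. \<lambda>k\<in>K. xs (f k)"
  have "H J xs = H K (?r xs)" for xs
    unfolding reg_cov_reindex[OF f] by (subst reg_cov_cong[of K _ "?r xs"]) auto
  moreover have fK: "f k \<in> J" if "k \<in> K" for k
    using f that by (auto simp: bij_betw_def)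
  then have "?r \<in> measurable (PiM J (\<lambda>_. N)) (PiM K (\<lambda>_. N))"
    by (intro measurable_restrict measurable_component_singleton)
  moreover have "distr (PiM J (\<lambda>_. N)) (PiM K (\<lambda>_. N)) ?r = PiM K (\<lambda>_. N)"
    using f fK distr_PiM_reindex[of J "\<lambda>_. N" f K] prob_space_axioms
    by (auto simp: bij_betw_def)
  ultimately show ?thesis
    using integral_distr[of ?r "PiM J (\<lambda>_. N)" "PiM K (\<lambda>_. N)" "\<lambda>xs. mtr (H K xs * B)"]
      mtr_H_mult_integrable[OF K B] by simp
qed

lemma H_fun_upd:
  assumes "k \<notin> K"
  shows "H K (xs(k := y)) = H K xs"
  using assms by (subst reg_cov_cong[of K _ xs]) auto

text \<open>Separates the point from the inverse: on the right, \<open>H K xs\<close> does not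
  involve \<open>xs k\<close>.\<close>

lemma leave_one_out:
  assumes K: "finite K" "k \<notin> K"
  shows "1 - c * q (insert k K) xs (xs k) = 1 / (1 + c * q K xs (xs k))"
  using K by (intro rank_one_minv_quad[OF pd pd to_vec_carrier c reg_cov_insert_mult_vec]) auto

lemma quad_form_nonneg: "finite K \<Longrightarrow> 0 \<le> c * q K xs x"
  using pd_minv_quad_nonneg[OF pd to_vec_carrier] c by simp

text \<open>With the points in \<open>K\<close> fixed, the tangent line bounds \<open>f\<close>
  below by an affine expression in \<open>q\<close>, whose mean over the new point is a trace; the
  result is then averaged over \<open>K\<close>. The parameter \<open>t\<close> stays free until the
  limit is taken.\<close>

lemma leave_one_out_expectation:
  assumes K: "finite K" "k \<notin> K"
  defines "f \<equiv> \<lambda>xs. 1 - c * q (insert k K) xs (xs k)"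
  shows "integrable (PiM (insert k K) (\<lambda>_. N)) f"
    and "2 * t - t\<^sup>2 * (1 + c * (\<integral>xs. mtr (H K xs * S) \<partial>PiM K (\<lambda>_. N)))
      \<le> integral\<^sup>L (PiM (insert k K) (\<lambda>_. N)) f"
proof -
  interpret PK: prob_space "PiM K (\<lambda>_. N)"
    by (intro prob_space_PiM prob_space_axioms)
  have f: "f = (\<lambda>xs. 1 / (1 + c * q K xs (xs k)))"
    unfolding f_def leave_one_out[OF K] ..
  have meas: "f \<in> borel_measurable (PiM (insert k K) (\<lambda>_. N))"
    unfolding f using K
    by (intro borel_measurable_divide borel_measurable_add borel_measurable_times
        borel_measurable_const quad_form_measurable) auto
  have bound: "\<bar>f xs\<bar> \<le> 1" for xs
    unfolding f using quad_form_nonneg[OF K(1), where xs = xs and x = "xs k"] by simp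
  note F = PiM_insert_bounded[OF K meas bound]
  show "integrable (PiM (insert k K) (\<lambda>_. N)) f"
    by (rule F)
  have inner: "2 * t - t\<^sup>2 * (1 + c * mtr (H K xs * S)) \<le> (\<integral>y. f (xs(k := y)) \<partial>N)"
    if xs: "xs \<in> space (PiM K (\<lambda>_. N))" for xs
  proof -
    note Q = quad_form_expectation[OF H_carrier[OF K(1), of xs]]
    have "2 * t - t\<^sup>2 * (1 + c * mtr (H K xs * S)) = expectation (\<lambda>y. 2 * t - t\<^sup>2 * (1 + c * q K xs y))"
      using Q by (simp add: prob_space)
    also have "\<dots> \<le> (\<integral>y. f (xs(k := y)) \<partial>N)"
    proof (rule integral_mono[OF _ F(4)[OF xs]])
      show "integrable N (\<lambda>y. 2 * t - t\<^sup>2 * (1 + c * q K xs y))"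
        using Q(1) by simp
      show "2 * t - t\<^sup>2 * (1 + c * q K xs y) \<le> f (xs(k := y))" for y
        unfolding f using quad_form_nonneg[OF K(1), where xs = xs and x = y]
        by (simp add: H_fun_upd[OF K(2)] tangent_le_inverse)
    qed
    finally show ?thesis .
  qed
  note T = mtr_H_mult_integrable[OF K(1) S_carrier]
  have "2 * t - t\<^sup>2 * (1 + c * (\<integral>xs. mtr (H K xs * S) \<partial>PiM K (\<lambda>_. N)))
    = (\<integral>xs. 2 * t - t\<^sup>2 * (1 + c * mtr (H K xs * S)) \<partial>PiM K (\<lambda>_. N))"
    using T by (simp add: PK.prob_space)
  also have "\<dots> \<le> (\<integral>xs. (\<integral>y. f (xs(k := y)) \<partial>N) \<partial>PiM K (\<lambda>_. N))"
    using T inner by (intro integral_mono F(2)) auto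
  also have "\<dots> = integral\<^sup>L (PiM (insert k K) (\<lambda>_. N)) f"
    by (rule F(3)[symmetric])
  finally show "2 * t - t\<^sup>2 * (1 + c * (\<integral>xs. mtr (H K xs * S) \<partial>PiM K (\<lambda>_. N)))
      \<le> integral\<^sup>L (PiM (insert k K) (\<lambda>_. N)) f" .
qed

text \<open>The rank-one comparison holds for every value of the new point and is then
  integrated.\<close>

lemma mtr_H_antimono:
  assumes K: "finite K" "k \<notin> K"
  shows "(\<integral>xs. mtr (H (insert k K) xs) \<partial>PiM (insert k K) (\<lambda>_. N))
    \<le> (\<integral>xs. mtr (H K xs) \<partial>PiM K (\<lambda>_. N))"
proof -
  let ?f = "\<lambda>xs. mtr (H (insert k K) xs)"
  have fin: "finite (insert k K)" using K by simp
  have bound: "\<bar>?f xs\<bar> \<le> real d * (1 / l)" for xs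
  proof -
    have "\<bar>?f xs\<bar> \<le> (\<Sum>i<d. \<bar>H (insert k K) xs $$ (i,i)\<bar>)"
      unfolding mtr_def carrier_matD(1)[OF H_carrier[OF fin]] by (rule sum_abs)
    also have "\<dots> \<le> (\<Sum>i<d. 1 / l)"
      by (intro sum_mono pd_minv_entry_bound[OF pd[OF fin]]) auto
    finally show ?thesis by simp
  qed
  note F = PiM_insert_bounded[OF K borel_measurable_integrable[OF mtr_H_integrable[OF fin]] bound]
  have "?f (xs(k := y)) \<le> mtr (H K xs)" for xs y
  proof -
    have "?f (xs(k := y)) \<le> mtr (H K (xs(k := y)))"
      using K by (intro rank_one_mtr_minv_le[OF pd pd to_vec_carrier c reg_cov_insert_mult_vec]) auto
    then show ?thesis by (simp only: H_fun_upd[OF K(2)])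
  qed
  then have "(\<integral>y. ?f (xs(k := y)) \<partial>N) \<le> mtr (H K xs)" if "xs \<in> space (PiM K (\<lambda>_. N))" for xs
    using F(4)[OF that] by (intro integral_le_const) auto
  then show ?thesis
    unfolding F(3) by (intro integral_mono F(2) mtr_H_integrable K) auto
qed

text \<open>The trace identity is applied to \<open>Suc n\<close> points, so that each leave-one-out
  sample has \<open>n\<close> points and contributes the same \<open>T n\<close>.
  \<open>mtr_H_antimono\<close> brings the remaining trace back to \<open>n\<close> points.\<close>

lemma sample_inequality:
  defines "T n \<equiv> \<integral>xs. mtr (H {..<n} xs * S) \<partial>PiM {..<n} (\<lambda>_. N)"
    and "R n \<equiv> \<integral>xs. mtr (H {..<n} xs) \<partial>PiM {..<n} (\<lambda>_. N)"
  shows "real (Suc n) * (2 * t - t\<^sup>2 * (1 + c * T n)) \<le> real (Suc n) - real d + l * R n"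
proof -
  let ?J = "{..<Suc n}"
  let ?M = "PiM ?J (\<lambda>_. N)"
  let ?f = "\<lambda>k xs. 1 - c * q ?J xs (xs k)"
  interpret M: prob_space ?M
    by (intro prob_space_PiM prob_space_axioms)
  have f: "integrable ?M (?f k)" "2 * t - t\<^sup>2 * (1 + c * T n) \<le> integral\<^sup>L ?M (?f k)"
    if k: "k < Suc n" for k
  proof -
    \<comment> \<open>\<open>K\<close> has \<open>n\<close> elements but need not be
      \<open>{..<n}\<close>; a bijection and exchangeability identify the two traces.\<close>
    define K where "K = ?J - {k}"
    have K: "finite K" "k \<notin> K" "insert k K = ?J"
      using k by (auto simp: K_def)
    have "card K = card {..<n}"
      using k by (simp add: K_def)
    then obtain g where g: "bij_betw g K {..<n}"
      using K(1) finite_same_card_bij by blast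
    have "T n = (\<integral>xs. mtr (H K xs * S) \<partial>PiM K (\<lambda>_. N))"
      unfolding T_def by (rule mtr_H_mult_exchange[OF g K(1) S_carrier])
    then show "integrable ?M (?f k)" "2 * t - t\<^sup>2 * (1 + c * T n) \<le> integral\<^sup>L ?M (?f k)"
      using leave_one_out_expectation(1)[OF K(1,2)] leave_one_out_expectation(2)[OF K(1,2), of t]
      unfolding K(3) by auto
  qed
  have "real (Suc n) * (2 * t - t\<^sup>2 * (1 + c * T n)) \<le> (\<Sum>k<Suc n. integral\<^sup>L ?M (?f k))"
    using sum_bounded_below[of ?J "2 * t - t\<^sup>2 * (1 + c * T n)" "\<lambda>k. integral\<^sup>L ?M (?f k)"] f(2) by simp
  also have "\<dots> = integral\<^sup>L ?M (\<lambda>xs. \<Sum>k<Suc n. ?f k xs)"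
    using f(1) by (intro Bochner_Integration.integral_sum[symmetric]) auto
  also have "(\<lambda>xs. \<Sum>k<Suc n. ?f k xs) = (\<lambda>xs. real (Suc n) - real d + l * mtr (H ?J xs))"
  proof
    fix xs
    have "(\<Sum>k<Suc n. c * q ?J xs (xs k)) = real d - l * mtr (H ?J xs)"
      by (rule reg_cov_mtr_identity[OF _ l c refl]) simp
    then show "(\<Sum>k<Suc n. ?f k xs) = real (Suc n) - real d + l * mtr (H ?J xs)"
      by (simp add: sum_subtractf del: sum.lessThan_Suc)
  qed
  also have "integral\<^sup>L ?M \<dots> = real (Suc n) - real d + l * (\<integral>xs. mtr (H ?J xs) \<partial>?M)"
    using mtr_H_integrable[of ?J] by (simp add: M.prob_space)
  also have "\<dots> \<le> real (Suc n) - real d + l * R n"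
    using mtr_H_antimono[of "{..<n}" n] l by (simp add: R_def lessThan_Suc)
  finally show ?thesis .
qed

text \<open>Writing \<open>E n = B + G\<close> leaves \<open>s n\<close> as the only unknown. The
  \<open>G\<close> parts contribute at most \<open>d\<close> and \<open>d / m\<close> to the two
  traces, the \<open>B\<close> parts at most \<open>s n * (d * M)\<close> and
  \<open>d * s n\<close>.\<close>

lemma spec_norm_inequality:
  defines "E n \<equiv> mat_expectation (PiM {..<n} (\<lambda>_. N)) d (H {..<n})"
  defines "s n \<equiv> spec_norm (E n - minv (S + l \<cdot>\<^sub>m 1\<^sub>m d))"
  assumes m: "0 < m" and ev: "\<And>k. eigenvalue S k \<Longrightarrow> m \<le> k \<and> k \<le> M" and d: "0 < d"
  shows "real (Suc n) * (2 * t - t\<^sup>2 * (1 + c * (real d * (1 + s n * M))))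
    \<le> real (Suc n) - real d + l * (real d * (s n + 1 / m))"
proof -
  let ?Q = "PiM {..<n} (\<lambda>_. N)"
  define G where "G = minv (S + l \<cdot>\<^sub>m 1\<^sub>m d)"
  define B where "B = E n - G"
  have car: "E n \<in> carrier_mat d d" "G \<in> carrier_mat d d" "B \<in> carrier_mat d d"
    using pd_minv(1)[OF S_reg_pd[OF l]] by (auto simp: E_def mat_expectation_def G_def B_def)
  have s: "s n = spec_norm B"
    by (simp add: s_def B_def G_def)
  have E: "mtr (E n * A) = (\<integral>xs. mtr (H {..<n} xs * A) \<partial>?Q)" if A: "A \<in> carrier_mat d d" for A
  proof -
    have HA: "integrable ?Q (\<lambda>xs. H {..<n} xs $$ (i,j) * A $$ (j,i))" if "i < d" "j < d" for i j
      using H_integrable[OF finite_lessThan that] by simp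
    show ?thesis
      unfolding mtr_mult[OF H_carrier[OF finite_lessThan] A] mtr_mult[OF car(1) A]
      by (subst Bochner_Integration.integral_sum,
          (intro Bochner_Integration.integrable_sum HA; simp),
          intro sum.cong refl, subst Bochner_Integration.integral_sum)
        (auto intro!: HA sum.cong simp: E_def mat_expectation_def H_integrable)
  qed
  have split: "mtr (E n * A) = mtr (B * A) + mtr (G * A)" if A: "A \<in> carrier_mat d d" for A
    unfolding mtr_mult[OF car(1) A] mtr_mult[OF car(2) A] mtr_mult[OF car(3) A] sum.distrib[symmetric]
    using car by (intro sum.cong refl) (simp add: B_def algebra_simps)
  have s0: "0 \<le> s n"
    unfolding s by (rule spec_norm_nonneg[OF car(3) d])
  have T: "(\<integral>xs. mtr (H {..<n} xs * S) \<partial>?Q) \<le> real d * (1 + s n * M)"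
  proof -
    have "mtr S \<le> real d * M"
      using S_sym ev by (intro symmetric_mtr_le S_carrier) auto
    then have "mtr (B * S) \<le> s n * (real d * M)"
      using mtr_mult_S_le_spec_norm[OF car(3)] s0 mult_left_mono order_trans unfolding s by blast
    then show ?thesis
      using mtr_reg_inverse_mult_S_le[OF l]
      unfolding E[OF S_carrier, symmetric] split[OF S_carrier] G_def[symmetric]
      by (simp add: algebra_simps)
  qed
  have R: "(\<integral>xs. mtr (H {..<n} xs) \<partial>?Q) \<le> real d * (s n + 1 / m)"
  proof -
    have "(\<integral>xs. mtr (H {..<n} xs) \<partial>?Q) = mtr (B * 1\<^sub>m d) + mtr (G * 1\<^sub>m d)"
      using E[of "1\<^sub>m d"] split[of "1\<^sub>m d"]
      by (simp add: right_mult_one_mat[OF H_carrier[OF finite_lessThan]])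
    also have "\<dots> = mtr B + mtr G"
      using car by simp
    also have "\<dots> \<le> real d * s n + real d * (1 / m)"
      unfolding s G_def using mtr_le_spec_norm[OF car(3)] mtr_reg_inverse_le[OF l m] ev
      by (intro add_mono) auto
    finally show ?thesis
      by (simp add: algebra_simps)
  qed
  \<comment> \<open>The trace against \<open>S\<close> enters with a negative sign, so its upper
    bound \<open>T\<close> lowers the left side.\<close>
  have "real (Suc n) * (2 * t - t\<^sup>2 * (1 + c * (real d * (1 + s n * M))))
    \<le> real (Suc n) * (2 * t - t\<^sup>2 * (1 + c * (\<integral>xs. mtr (H {..<n} xs * S) \<partial>?Q)))"
    using T c by (intro mult_left_mono diff_left_mono add_left_mono) auto
  also have "\<dots> \<le> real (Suc n) - real d + l * (\<integral>xs. mtr (H {..<n} xs) \<partial>?Q)"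
    by (rule sample_inequality)
  also have "\<dots> \<le> real (Suc n) - real d + l * (real d * (s n + 1 / m))"
    using R l by simp
  finally show ?thesis .
qed

end

section \<open>Passage to the limit\<close>

lemma sample_cov_reg:
  "sample_cov n d xs + l \<cdot>\<^sub>m 1\<^sub>m d = reg_cov d l (1 / real n) {..<n} xs"
  by (simp add: sample_cov_def reg_cov_def)

theorem theorem2p5:
  fixes d :: "nat \<Rightarrow> nat"
    and P :: "nat \<Rightarrow> (nat \<Rightarrow> real) measure"
    and Sigma :: "nat \<Rightarrow> real mat"
    and lam :: "nat \<Rightarrow> real"
    and y smin smax :: real
  assumes dim_to_inf: "filterlim d at_top sequentially"
    and ratio: "(\<lambda>n. real (d n) / real n) \<longlonglongrightarrow> y"
    and y_range: "0 \<le> y" "y < 1"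
    and prob: "\<And>n. prob_space (P n)"
    and sets_P: "\<And>n. sets (P n) = sets (PiM {..<d n} (\<lambda>_. borel))"
    and mean_zero: "\<And>n i. i < d n \<Longrightarrow>
          integrable (P n) (\<lambda>x. x i) \<and> integral\<^sup>L (P n) (\<lambda>x. x i) = 0"
    and Sigma_dim: "\<And>n. Sigma n \<in> carrier_mat (d n) (d n)"
    and cov: "\<And>n i j. i < d n \<Longrightarrow> j < d n \<Longrightarrow>
          integrable (P n) (\<lambda>x. x i * x j) \<and> Sigma n $$ (i,j) = integral\<^sup>L (P n) (\<lambda>x. x i * x j)"
    and A1: "\<exists>F :: real \<Rightarrow> real. AE u in lborel. u \<ge> 0 \<longrightarrow>
          (\<lambda>n. esd (Sigma n) u) \<longlonglongrightarrow> F u"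
    and A2_M: "\<exists>B. \<forall>n. \<forall>e \<in> carrier_vec (d n). vnorm e = 1 \<longrightarrow>
          integrable (P n) (\<lambda>x. (scalar_prod e (to_vec (d n) x)) ^ 4) \<and>
          integral\<^sup>L (P n) (\<lambda>x. (scalar_prod e (to_vec (d n) x)) ^ 4) \<le> B"
    and A2_nu: "\<forall>\<epsilon>>0. \<forall>\<^sub>F n in sequentially. \<forall>\<Omega> \<in> carrier_mat (d n) (d n). spec_norm \<Omega> = 1 \<longrightarrow>
          prob_space.variance (P n)
            (\<lambda>x. scalar_prod (to_vec (d n) x) (\<Omega> *\<^sub>v to_vec (d n) x) / real (d n)) \<le> \<epsilon>"
    and A3: "0 < smin" "\<And>n k. eigenvalue (Sigma n) k \<Longrightarrow> smin \<le> k \<and> k \<le> smax"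
    and lam_pos: "\<And>n. lam n > 0"
    and lam_zero: "lam \<longlonglongrightarrow> 0"
  shows "liminf (\<lambda>n. ereal (spec_norm
            (mat_expectation (PiM {..<n} (\<lambda>_. P n)) (d n)
                (\<lambda>xs. minv (sample_cov n (d n) xs + lam n \<cdot>\<^sub>m 1\<^sub>m (d n)))
             - minv (Sigma n + lam n \<cdot>\<^sub>m 1\<^sub>m (d n)))))
         \<ge> ereal (y * smin / smax\<^sup>2)"
proof -
  define s where "s n = spec_norm
            (mat_expectation (PiM {..<n} (\<lambda>_. P n)) (d n)
                (\<lambda>xs. minv (sample_cov n (d n) xs + lam n \<cdot>\<^sub>m 1\<^sub>m (d n)))
             - minv (Sigma n + lam n \<cdot>\<^sub>m 1\<^sub>m (d n)))" for n
  have model: "second_moment_model (P n) (d n) (Sigma n)" for n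
    using prob sets_P Sigma_dim cov
    by (auto simp: second_moment_model_def second_moment_model_axioms_def)
  \<comment> \<open>At \<open>n = 0\<close> the scale \<open>1 / real n\<close> is 0 by convention,
    which still meets \<open>0 \<le> c\<close>.\<close>
  have ridge: "ridge_model (P n) (d n) (Sigma n) (lam n) (1 / real n)" for n
    using model lam_pos by (auto simp: ridge_model_def ridge_model_axioms_def)
  have d_pos: "\<forall>\<^sub>F n in sequentially. 0 < d n"
    using eventually_compose_filterlim[OF eventually_gt_at_top[of 0] dim_to_inf] .
  have s_nonneg: "0 \<le> s n" if "0 < d n" for n
    unfolding s_def using that pd_minv(1)[OF second_moment_model.S_reg_pd[OF model lam_pos]]
    by (intro spec_norm_nonneg[of _ "d n"] minus_carrier_mat)
  obtain n0 where n0: "0 < d n0"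
    using eventually_happens[OF d_pos] by auto
  have "\<exists>k. eigenvalue (Sigma n0) k"
    using second_moment_model.S_sym[OF model] by (intro symmetric_eigenvalue_ex[OF Sigma_dim n0]) auto
  then have sm: "smin \<le> smax"
    using A3(2) order_trans by blast
  \<comment> \<open>The bound on the liminf amounts to this: each \<open>C\<close> below the target
    is eventually exceeded.\<close>
  have ev: "\<forall>\<^sub>F n in sequentially. C < s n" if C: "C < y * smin / smax\<^sup>2" for C
  proof (cases "y = 0")
    \<comment> \<open>The target is 0 here, and nonnegativity of the norm suffices. The limit
      computed in the other case carries a factor \<open>y\<close> and would vanish.\<close>
    case True
    then have "C < 0" using C by simp
    then show ?thesis
      using d_pos s_nonneg by (elim eventually_mono) (use less_le_trans in blast)
  next
    case False
    then have y: "0 < y" using y_range by simp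
    \<comment> \<open>the limit of \<open>E (1 / (1 + q))\<close> under bounded \<open>s n\<close>, which is the optimal \<open>t\<close>\<close>
    define t where "t = 1 - y"
    have t: "0 < t" "t < 1" using y y_range by (auto simp: t_def)
    \<comment> \<open>The left side minus the right side of \<open>spec_norm_inequality\<close>,
      divided by \<open>Suc n\<close>, with \<open>C\<close> in place of \<open>s n\<close>. A
      positive value refutes \<open>s n \<le> C\<close>.\<close>
    define L where "L n = 2 * t - t\<^sup>2 * (1 + real (d n) / real n * (1 + C * smax))
      - (1 - real (d n) / real (Suc n) + lam n * (real (d n) / real (Suc n) * (C + 1 / smin)))" for n
    have ratio': "(\<lambda>n. real (d n) / real (Suc n)) \<longlonglongrightarrow> y"
    proof -
      have "(\<lambda>n. real (d n) / real n * (real n / real (Suc n))) \<longlonglongrightarrow> y * 1"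
        by (intro tendsto_mult ratio LIMSEQ_n_over_Suc_n)
      moreover have "\<forall>\<^sub>F n in sequentially. real (d n) / real n * (real n / real (Suc n)) = real (d n) / real (Suc n)"
        using eventually_gt_at_top[of 0] by eventually_elim auto
      ultimately show ?thesis
        using Lim_transform_eventually by fastforce
    qed
    have "L \<longlonglongrightarrow> 2 * t - t\<^sup>2 * (1 + y * (1 + C * smax)) - (1 - y + 0 * (y * (C + 1 / smin)))"
      unfolding L_def by (intro tendsto_intros ratio ratio' lam_zero)
    also have "2 * t - t\<^sup>2 * (1 + y * (1 + C * smax)) - (1 - y + 0 * (y * (C + 1 / smin)))
      = t * y * (y - t * (C * smax))"
      by (simp add: t_def power2_eq_square algebra_simps)
    finally have lim: "L \<longlonglongrightarrow> t * y * (y - t * (C * smax))" .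
    \<comment> \<open>The limit is positive whenever \<open>C * smax < y / (1 - y)\<close>. The
      choice of \<open>C\<close> gives even \<open>C * smax < y\<close>, because
      \<open>smin \<le> smax\<close>.\<close>
    have "C * smax < y * smin / smax\<^sup>2 * smax"
      using C sm A3(1) by (intro mult_strict_right_mono) auto
    also have "\<dots> = y * (smin / smax)"
      using sm A3(1) by (simp add: power2_eq_square)
    also have "\<dots> \<le> y * 1"
      using sm A3(1) y by (intro mult_left_mono) auto
    finally have "t * (C * smax) < t * y"
      using t by simp
    also have "\<dots> < y"
      using t y by simp
    finally have "0 < t * y * (y - t * (C * smax))"
      using t y by simp
    then have "\<forall>\<^sub>F n in sequentially. 0 < L n"
      by (rule order_tendstoD(1)[OF lim])
    then show ?thesis
      using d_pos
    proof eventually_elim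
      case (elim n)
      interpret ridge_model "P n" "d n" "Sigma n" "lam n" "1 / real n"
        by (rule ridge)
      show "C < s n"
      proof (rule ccontr)
        assume "\<not> C < s n"
        then have sC: "s n \<le> C" by simp
        let ?N = "real (Suc n)"
        \<comment> \<open>In \<open>s n\<close> the left side of the inequality is decreasing and
          the right side increasing, so \<open>C\<close> may replace \<open>s n\<close> on
          both.\<close>
        have "?N * (2 * t - t\<^sup>2 * (1 + 1 / real n * (real (d n) * (1 + C * smax))))
          \<le> ?N * (2 * t - t\<^sup>2 * (1 + 1 / real n * (real (d n) * (1 + s n * smax))))"
          using sC sm A3(1)
          by (intro mult_left_mono diff_left_mono add_left_mono mult_right_mono) auto
        also have "\<dots> \<le> ?N - real (d n) + lam n * (real (d n) * (s n + 1 / smin))"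
          unfolding s_def sample_cov_reg
          by (rule spec_norm_inequality[OF A3(1) A3(2) elim(2)])
        also have "\<dots> \<le> ?N - real (d n) + lam n * (real (d n) * (C + 1 / smin))"
          using sC lam_pos[of n] by (intro add_left_mono mult_left_mono) auto
        also have "\<dots> = ?N * (1 - real (d n) / ?N + lam n * (real (d n) / ?N * (C + 1 / smin)))"
          by (simp add: field_simps del: of_nat_Suc)
        finally have "?N * L n \<le> 0"
          unfolding L_def right_diff_distrib[of ?N] by (simp del: of_nat_Suc)
        then show False
          using elim(1) by (simp add: mult_le_0_iff)
      qed
    qed
  qed
  have "ereal (y * smin / smax\<^sup>2) \<le> liminf (\<lambda>n. ereal (s n))"
    unfolding le_Liminf_iff
  proof (intro allI impI)
    fix z assume z: "z < ereal (y * smin / smax\<^sup>2)"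
    show "\<forall>\<^sub>F n in sequentially. z < ereal (s n)"
    proof (cases z)
      case (real r)
      then show ?thesis
        using ev[of r] z by simp
    qed (use z in auto)
  qed
  then show ?thesis
    by (simp add: s_def)
qed

end
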